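(* As $h\to\infty$, $|\Omega(h)| = O\left(\frac{5^{h}}{\sqrt{h^{3}}}\right)$.
   Context: For a positive integer $h$, let $\Omega(h)$ (the set of states of the paper's dynamic program for the rectilinear Steiner tree problem) be the set of pairs $(Z,\pi)$ where $Z\subseteq\{1,\dots,h\}$ (the indices of positive-degree vertices) and $\pi$ is a non-crossing partition of $Z$, i.e., there are no $a<b<c<d$ in $Z$ with $a,c$ in one block and $b,d$ in a different block. *)

theory Defs
  imports Complex_Main "HOL-Library.Disjoint_Sets" "HOL-Library.Landau_Symbols"
begin

definition noncrossing :: "'a::linorder set set \<Rightarrow> bool" where
  "noncrossing P \<longleftrightarrow>
     \<not> (\<exists>B\<in>P. \<exists>C\<in>P. B \<noteq> C \<and>
          (\<exists>a b c d. a < b \<and> b < c \<and> c < d \<and> a \<in> B \<and> c \<in> B \<and> b \<in> C \<and> d \<in> C))"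

text \<open>For \<open>Z = {}\<close> there is exactly one partition, the empty one, so \<open>({}, {})\<close> is a state.\<close>

definition Omega :: "nat \<Rightarrow> (nat set \<times> nat set set) set" where
  "Omega h = {(Z, P). Z \<subseteq> {1..h} \<and> partition_on Z P \<and> noncrossing P}"

text \<open>The set of states is finite, so its \<^const>\<open>card\<close> is its genuine cardinality.\<close>

lemma finite_Omega: "finite (Omega h)"
proof (rule finite_subset)
  show "Omega h \<subseteq> Pow {1..h} \<times> Pow (Pow {1..h})"
    by (fastforce simp: Omega_def partition_on_def)
qed simp

end

theory Submission
  imports Defs
begin

text \<open>
  Cutting a non-crossing partition of \<open>Z\<close> after the last element of the block of \<open>min Z\<close> yields the
  Catalan recurrence, so \<open>Z\<close> has at most \<open>C\<^sub>k \<le> 4\<^sup>k / (k + 1)\<^bsup>3/2\<^esup>\<close> such partitions, where \<open>k = |Z|\<close>.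
  It remains to bound \<open>\<Sum>k. binom(h, k) 4\<^sup>k (k + 1)\<^bsup>-3/2\<^esup>\<close>. With \<open>s = h / (k + 1)\<close> the last factor is
  \<open>h\<^bsup>-3/2\<^esup> s\<^bsup>3/2\<^esup> \<le> h\<^bsup>-3/2\<^esup> (1 + s\<^sup>2)\<close>, and \<open>binom(h, k) s\<^sup>2 \<le> 2 binom(h + 2, k + 2)\<close>, so the binomial
  theorem gives a constant multiple of \<open>5\<^sup>h h\<^bsup>-3/2\<^esup>\<close>.
\<close>

section \<open>Catalan numbers\<close>

text \<open>The ratio recurrence serves as the definition because it makes the growth bound a short
  induction. The convolution identity that the counting needs is derived from it below.\<close>

fun catalan :: "nat \<Rightarrow> real" where
  "catalan 0 = 1"
| "catalan (Suc n) = (4 * real n + 2) / (real n + 2) * catalan n"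

lemma catalan_Suc_mult: "(real n + 2) * catalan (Suc n) = (4 * real n + 2) * catalan n"
  by simp

declare catalan.simps(2) [simp del]

lemma catalan_nonneg: "catalan n \<ge> 0"
  by (induction n) (simp_all add: catalan.simps(2))

text \<open>The reflection \<open>i\<close> to \<open>n - i\<close> fixes the product and swaps the
  weights \<open>i\<close> and \<open>n - i\<close>, which add up to \<open>n\<close>.\<close>

lemma sum_weighted_symmetric_convolution:
  fixes c :: "nat \<Rightarrow> real"
  shows "2 * (\<Sum>i\<le>n. real i * (c i * c (n - i))) = real n * (\<Sum>i\<le>n. c i * c (n - i))"
proof -
  have "(\<Sum>i\<le>n. real i * (c i * c (n - i))) = (\<Sum>i\<le>n. real (n - i) * (c (n - i) * c (n - (n - i))))"
    by (rule sum.nat_diff_reindex[symmetric, of _ "Suc n", simplified lessThan_Suc_atMost diff_Suc_Suc])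
  also have "\<dots> = (\<Sum>i\<le>n. (real n - real i) * (c i * c (n - i)))"
    by (intro sum.cong refl) (auto simp: of_nat_diff)
  also have "\<dots> = real n * (\<Sum>i\<le>n. c i * c (n - i)) - (\<Sum>i\<le>n. real i * (c i * c (n - i)))"
    by (simp add: left_diff_distrib sum_subtractf sum_distrib_left)
  finally show ?thesis by simp
qed

text \<open>
  Multiplying the first factor of the convolution by its index multiplies the sum by \<open>n/2\<close>, so the
  first-order recurrence of the Catalan numbers carries over to the convolution.
\<close>

lemma catalan_convolution: "(\<Sum>i\<le>n. catalan i * catalan (n - i)) = catalan (Suc n)"
proof (induction n)
  case 0
  then show ?case by (simp add: catalan.simps(2))
next
  case (Suc n)
  define S where "S k = (\<Sum>i\<le>k. catalan i * catalan (k - i))" for k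
  define T where "T k = (\<Sum>i\<le>k. real i * (catalan i * catalan (k - i)))" for k
  have T: "2 * T k = real k * S k" for k
    unfolding S_def T_def by (rule sum_weighted_symmetric_convolution)
  \<comment> \<open>The weight \<open>j + 1\<close> is chosen so that after the shift
    \<open>j = i + 1\<close> it becomes \<open>i + 2\<close>, the factor in
    \<open>catalan_Suc_mult\<close>. The term \<open>j = 0\<close> splits off as
    \<open>catalan (Suc n)\<close>.\<close>
  have "T (Suc n) + S (Suc n) = (\<Sum>j\<le>Suc n. (real j + 1) * catalan j * catalan (Suc n - j))"
    by (simp only: T_def S_def sum.distrib[symmetric]) (simp add: algebra_simps)
  also have "\<dots> = catalan (Suc n) + (\<Sum>i\<le>n. (real i + 2) * catalan (Suc i) * catalan (n - i))"
    by (subst sum.atMost_Suc_shift) (simp add: algebra_simps)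
  also have "\<dots> = catalan (Suc n) + (\<Sum>i\<le>n. (4 * real i + 2) * catalan i * catalan (n - i))"
    by (simp only: catalan_Suc_mult)
  also have "(\<Sum>i\<le>n. (4 * real i + 2) * catalan i * catalan (n - i)) = 4 * T n + 2 * S n"
    by (simp add: T_def S_def sum_distrib_left sum.distrib[symmetric] algebra_simps)
  finally have "T (Suc n) + S (Suc n) = catalan (Suc n) + (4 * T n + 2 * S n)" .
  moreover have "S n = catalan (Suc n)"
    using Suc.IH by (simp add: S_def)
  \<comment> \<open>Eliminating \<open>T\<close> and doubling leaves
    \<open>(n + 3) * S (Suc n)\<close> on the left and \<open>2 + 4 * (n + 1)\<close> copies of
    \<open>catalan (Suc n)\<close> on the right.\<close>
  ultimately have "(real (Suc n) + 2) * S (Suc n) = (4 * real (Suc n) + 2) * catalan (Suc n)"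
    using T[of n] T[of "Suc n"] by (simp add: algebra_simps)
  also have "\<dots> = (real (Suc n) + 2) * catalan (Suc (Suc n))"
    by (rule catalan_Suc_mult[symmetric])
  finally show ?case
    by (simp add: S_def)
qed

text \<open>Squaring removes the root from the exponent 3/2. The left side grows by a factor of at
  most 16 per step, which reduces to the polynomial inequality \<open>*\<close>.\<close>

lemma catalan_power2_le: "(catalan n)\<^sup>2 * (real n + 1) ^ 3 \<le> 16 ^ n"
proof (induction n)
  case (Suc n)
  have *: "(4 * real n + 2)\<^sup>2 * (real n + 2) \<le> 16 * (real n + 1) ^ 3"
    by (simp add: power2_eq_square power3_eq_cube algebra_simps)
  have "(catalan (Suc n))\<^sup>2 * (real (Suc n) + 1) ^ 3
      = (catalan n)\<^sup>2 * ((4 * real n + 2)\<^sup>2 * (real n + 2))"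
  proof -
    have "(u / q * c)\<^sup>2 * q ^ 3 = c\<^sup>2 * (u\<^sup>2 * q)" if "q \<noteq> 0" for u q c :: real
      using that by (simp add: power2_eq_square power3_eq_cube)
    from this[of "real n + 2" "4 * real n + 2" "catalan n"] show ?thesis
      by (simp add: catalan.simps(2) add.commute)
  qed
  also have "\<dots> \<le> (catalan n)\<^sup>2 * (16 * (real n + 1) ^ 3)"
    by (intro mult_left_mono *) simp
  also have "\<dots> \<le> 16 ^ Suc n"
    using Suc.IH by simp
  finally show ?case .
qed simp

lemma catalan_le: "catalan n \<le> 4 ^ n / sqrt ((real n + 1) ^ 3)"
proof -
  have "catalan n * sqrt ((real n + 1) ^ 3) = sqrt ((catalan n)\<^sup>2 * (real n + 1) ^ 3)"
    by (simp add: real_sqrt_mult catalan_nonneg)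
  also have "\<dots> \<le> sqrt (16 ^ n)"
    using catalan_power2_le by simp
  also have "\<dots> = sqrt ((4 ^ n)\<^sup>2)"
    by (simp add: power2_eq_square flip: power_mult_distrib)
  also have "\<dots> = 4 ^ n"
    by simp
  finally show ?thesis
    by (simp add: pos_le_divide_eq)
qed

section \<open>Counting non-crossing partitions\<close>

definition nc_partitions :: "'a::linorder set \<Rightarrow> 'a set set set" where
  "nc_partitions Z = {P. partition_on Z P \<and> noncrossing P}"

text \<open>Passing to the equivalence relation makes restriction a mere conjunction and lets
  partitions be compared pointwise.\<close>

definition same_block :: "'a set set \<Rightarrow> 'a \<Rightarrow> 'a \<Rightarrow> bool" where
  "same_block P x y \<longleftrightarrow> (\<exists>B\<in>P. x \<in> B \<and> y \<in> B)"

text \<open>Blocks disjoint from \<open>A\<close> leave an empty trace, which a partition may not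
  contain.\<close>

definition restrict_partition :: "'a set \<Rightarrow> 'a set set \<Rightarrow> 'a set set" where
  "restrict_partition A P = (\<inter>) A ` P - {{}}"

lemma noncrossingD:
  assumes "noncrossing P" "B \<in> P" "C \<in> P" "a < b" "b < c" "c < d" "a \<in> B" "c \<in> B" "b \<in> C" "d \<in> C"
  shows "B = C"
proof (rule ccontr)
  assume "B \<noteq> C"
  with assms(4-) have "B \<noteq> C \<and> (\<exists>a b c d. a < b \<and> b < c \<and> c < d \<and> a \<in> B \<and> c \<in> B \<and> b \<in> C \<and> d \<in> C)"
    by (intro conjI exI)
  with assms(1-3) show False
    unfolding noncrossing_def by (elim notE) (intro bexI)
qed

lemma finite_nc_partitions: "finite Z \<Longrightarrow> finite (nc_partitions Z)"
  by (rule finite_subset[of _ "Pow (Pow Z)"]) (fastforce simp: nc_partitions_def partition_on_def)+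

lemma same_block_sym: "same_block P x y \<Longrightarrow> same_block P y x"
  by (auto simp: same_block_def)

lemma same_block_trans:
  "partition_on Z P \<Longrightarrow> same_block P x y \<Longrightarrow> same_block P y z \<Longrightarrow> same_block P x z"
  unfolding same_block_def partition_on_def disjoint_def by blast

lemma same_block_mem: "partition_on Z P \<Longrightarrow> same_block P x y \<Longrightarrow> x \<in> Z \<and> y \<in> Z"
  by (auto simp: same_block_def partition_on_def)

lemma same_block_refl: "partition_on Z P \<Longrightarrow> x \<in> Z \<Longrightarrow> same_block P x x"
  by (auto simp: same_block_def partition_on_def)

text \<open>A partition is the quotient by its own block relation, so the relation determines
  it.\<close>

lemma partition_on_eqI:
  assumes "partition_on Z P" "partition_on Z Q" "\<And>x y. same_block P x y \<longleftrightarrow> same_block Q x y"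
  shows "P = Q"
proof -
  have "Z // {(x, y). same_block P x y} = P" "Z // {(x, y). same_block Q x y} = Q"
    using assms(1,2) partition_on_eq_quotient unfolding same_block_def by blast+
  moreover have "{(x, y). same_block P x y} = {(x, y). same_block Q x y}"
    using assms(3) by (intro Collect_cong) (auto split: prod.splits)
  ultimately show ?thesis by metis
qed

lemma same_block_restrict_partition:
  "same_block (restrict_partition A P) x y \<longleftrightarrow> x \<in> A \<and> y \<in> A \<and> same_block P x y"
  by (auto simp: same_block_def restrict_partition_def)

text \<open>Distinct traces on \<open>A\<close> come from distinct blocks of \<open>P\<close>, so a
  crossing in the restriction is already one in \<open>P\<close>.\<close>

lemma restrict_nc_partitions:
  assumes "P \<in> nc_partitions Z" "A \<subseteq> Z"
  shows "restrict_partition A P \<in> nc_partitions A"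
proof -
  have "partition_on A (restrict_partition A P)"
    using assms partition_on_restrict[of Z P A]
    by (simp add: nc_partitions_def restrict_partition_def Int_absorb2)
  moreover have "noncrossing (restrict_partition A P)"
    unfolding noncrossing_def
  proof (intro notI, elim bexE conjE exE)
    fix B C a b c d
    assume "B \<in> restrict_partition A P" "C \<in> restrict_partition A P" "B \<noteq> C"
      and lt: "a < b" "b < c" "c < d" and mem: "a \<in> B" "c \<in> B" "b \<in> C" "d \<in> C"
    then obtain B' C' where "B' \<in> P" "C' \<in> P" "B = A \<inter> B'" "C = A \<inter> C'" "B' \<noteq> C'"
      by (auto simp: restrict_partition_def)
    moreover have "noncrossing P"
      using assms by (simp add: nc_partitions_def)
    ultimately show False
      using lt mem noncrossingD[of P B' C' a b c d] by simp
  qed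
  ultimately show ?thesis
    by (simp add: nc_partitions_def)
qed

definition last_partner :: "'a::linorder set set \<Rightarrow> 'a \<Rightarrow> 'a" where
  "last_partner P m = Max {x. same_block P m x}"

lemma last_partner:
  assumes "finite Z" "partition_on Z P" "m \<in> Z"
  shows "same_block P m (last_partner P m)" "\<And>x. same_block P m x \<Longrightarrow> x \<le> last_partner P m"
proof -
  have fin: "finite {x. same_block P m x}"
    by (rule finite_subset[OF _ assms(1)]) (use same_block_mem[OF assms(2)] in blast)
  moreover have "m \<in> {x. same_block P m x}"
    using same_block_refl[OF assms(2,3)] by simp
  ultimately have "last_partner P m \<in> {x. same_block P m x}"
    unfolding last_partner_def by (intro Max_in) auto
  then show "same_block P m (last_partner P m)" by simp
  show "x \<le> last_partner P m" if "same_block P m x" for x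
    unfolding last_partner_def using fin that by (intro Max_ge) auto
qed

text \<open>
  No block reaches across the last element \<open>t\<close> of the block of the minimum \<open>m\<close>, and \<open>m\<close> itself may
  be replaced by \<open>t\<close>; so \<open>t\<close> and the restrictions to both sides of it determine the partition.
\<close>

lemma same_block_split:
  assumes Z: "finite Z" "m \<in> Z" "\<And>z. z \<in> Z \<Longrightarrow> m \<le> z" and P: "P \<in> nc_partitions Z"
    and t: "t = last_partner P m"
  defines "r \<equiv> \<lambda>x. if x = m then t else x"
  defines "A \<equiv> {x\<in>Z. m < x \<and> x \<le> t}" and "B \<equiv> {x\<in>Z. t < x}"
  shows "same_block P x y \<longleftrightarrow> x \<in> Z \<and> y \<in> Z \<and> (r x = r y \<or>
      same_block (restrict_partition A P) (r x) (r y) \<or> same_block (restrict_partition B P) (r x) (r y))"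
proof -
  have part: "partition_on Z P" and nc: "noncrossing P"
    using P by (auto simp: nc_partitions_def)
  have mt: "same_block P m t" and tmax: "\<And>x. same_block P m x \<Longrightarrow> x \<le> t"
    using last_partner[OF Z(1) part Z(2)] t by auto
  have tZ: "t \<in> Z"
    using same_block_mem[OF part mt] by simp
  have r: "same_block P x (r x)" if "x \<in> Z" for x
    using that mt same_block_refl[OF part] by (auto simp: r_def)
  have rZ: "r x \<in> Z" if "x \<in> Z" for x
    using that tZ by (auto simp: r_def)
  have rr: "same_block P x y \<longleftrightarrow> same_block P (r x) (r y)" if "x \<in> Z" "y \<in> Z" for x y
    using r[OF that(1)] r[OF that(2)] same_block_trans[OF part] same_block_sym by metis
  \<comment> \<open>Since \<open>t\<close> is the last element of the block of \<open>m\<close>,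
    neither \<open>y\<close> nor \<open>x\<close> lies in that block. Hence
    \<open>m < x < t < y\<close> alternates between two blocks, a crossing.\<close>
  have apart: False if xy: "same_block P x y" "x \<le> t" "t < y" for x y
  proof -
    have "\<not> same_block P m y"
      using tmax that by fastforce
    then have nmx: "\<not> same_block P m x"
      using same_block_trans[OF part _ xy(1)] by blast
    then have "x \<noteq> m" "x \<noteq> t"
      using mt same_block_refl[OF part Z(2)] by auto
    moreover have "x \<in> Z"
      using same_block_mem[OF part xy(1)] by simp
    ultimately have lt: "m < x" "x < t" "t < y"
      using Z(3)[of x] xy by auto
    obtain C where C: "C \<in> P" "m \<in> C" "t \<in> C"
      using mt by (auto simp: same_block_def)
    obtain D where D: "D \<in> P" "x \<in> D" "y \<in> D"
      using xy by (auto simp: same_block_def)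
    have "C \<noteq> D"
      using nmx C D by (auto simp: same_block_def)
    then show False
      using noncrossingD[OF nc C(1) D(1) lt C(2,3) D(2,3)] by simp
  qed
  \<comment> \<open>The exception \<open>t = m\<close> means that \<open>{m}\<close> is a block.
    Then \<open>r m = m\<close> lies in neither part, and the disjunct \<open>r x = r y\<close>
    accounts for it.\<close>
  have rAB: "r x \<in> A \<union> B \<or> r x = m \<and> t = m" if "x \<in> Z" for x
    using rZ[OF that] Z(3)[OF rZ[OF that]] Z(3)[OF that] unfolding A_def B_def r_def by force
  have main: "same_block P (r x) (r y) \<longleftrightarrow> r x = r y \<or>
      r x \<in> A \<and> r y \<in> A \<and> same_block P (r x) (r y) \<or>
      r x \<in> B \<and> r y \<in> B \<and> same_block P (r x) (r y)" if xy: "x \<in> Z" "y \<in> Z" for x y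
  proof (intro iffI)
    assume s: "same_block P (r x) (r y)"
    note a = apart[OF s] apart[OF same_block_sym[OF s]]
    show "r x = r y \<or> r x \<in> A \<and> r y \<in> A \<and> same_block P (r x) (r y) \<or>
      r x \<in> B \<and> r y \<in> B \<and> same_block P (r x) (r y)"
      using rAB[OF xy(1)] rAB[OF xy(2)] a s unfolding A_def B_def by force
  next
    assume "r x = r y \<or> r x \<in> A \<and> r y \<in> A \<and> same_block P (r x) (r y) \<or>
      r x \<in> B \<and> r y \<in> B \<and> same_block P (r x) (r y)"
    then show "same_block P (r x) (r y)"
      using same_block_refl[OF part rZ[OF xy(1)]] by auto
  qed
  show ?thesis
  proof (cases "x \<in> Z \<and> y \<in> Z")
    case True
    then show ?thesis
      using rr[of x y] main[of x y] unfolding same_block_restrict_partition by blast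
  next
    case False
    then show ?thesis
      using same_block_mem[OF part] by blast
  qed
qed

text \<open>By \<open>same_block_split\<close>, a partition is encoded injectively by
  \<open>t\<close> and its two restrictions. Both sides of the cut have fewer elements than
  \<open>Z\<close>, so strong induction bounds the count by the Catalan convolution.\<close>

lemma card_nc_partitions_le:
  assumes "finite Z"
  shows "real (card (nc_partitions Z)) \<le> catalan (card Z)"
  using assms
proof (induction "card Z" arbitrary: Z rule: less_induct)
  case less
  show ?case
  proof (cases "Z = {}")
    case True
    then have "nc_partitions Z \<subseteq> {{}}"
      by (auto simp: nc_partitions_def partition_on_empty)
    then have "card (nc_partitions Z) \<le> card {{} :: 'a set set}"
      by (intro card_mono) auto
    with True show ?thesis by simp
  next
    case False
    define m where "m = Min Z"
    have m: "m \<in> Z" "\<And>z. z \<in> Z \<Longrightarrow> m \<le> z"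
      using False less.prems by (auto simp: m_def)
    obtain n where n: "card Z = Suc n"
      using False less.prems by (cases "card Z") auto
    define A where "A t = {x\<in>Z. m < x \<and> x \<le> t}" for t
    define B where "B t = {x\<in>Z. t < x}" for t
    define f where "f P = (let t = last_partner P m in
        (t, restrict_partition (A t) P, restrict_partition (B t) P))" for P
    have sub: "A t \<subseteq> Z" "B t \<subseteq> Z" for t
      by (auto simp: A_def B_def)
    note fin = sub[THEN finite_subset, OF less.prems]
    \<comment> \<open>Only \<open>m\<close> is dropped, being represented by \<open>t\<close>; this
      gives the index \<open>n\<close> rather than \<open>n + 1\<close> in the convolution.\<close>
    have cardAB: "card (A t) + card (B t) = n" if "t \<in> Z" for t
    proof -
      have "A t \<union> B t = Z - {m}" "A t \<inter> B t = {}"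
        using that m(2)[OF that] by (auto simp: A_def B_def dest: m(2) intro: le_neq_trans)
      then have "card (A t) + card (B t) = card (Z - {m})"
        using fin card_Un_disjoint[of "A t" "B t"] by simp
      also have "\<dots> = n"
        using m(1) less.prems n by simp
      finally show ?thesis .
    qed
    \<comment> \<open>For \<open>s < t\<close> the element \<open>t\<close> itself makes
      \<open>A t\<close> strictly larger, so the size of \<open>A t\<close> can replace
      \<open>t\<close> as summation index.\<close>
    have injA: "inj_on (\<lambda>t. card (A t)) Z"
    proof (rule linorder_inj_onI)
      fix s t assume st: "s < t" "s \<in> Z" "t \<in> Z"
      have "A s \<subseteq> A t"
        using st(1) by (auto simp: A_def)
      moreover have "t \<in> A t" "t \<notin> A s"
        using st m(2)[of s] by (auto simp: A_def)
      ultimately have "A s \<subset> A t"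
        by blast
      then have "card (A s) < card (A t)"
        using fin by (intro psubset_card_mono)
      then show "card (A s) \<noteq> card (A t)" by simp
    qed auto
    have "inj_on f (nc_partitions Z)"
    proof (rule inj_onI)
      fix P Q assume PQ: "P \<in> nc_partitions Z" "Q \<in> nc_partitions Z" and eq: "f P = f Q"
      define t where "t = last_partner P m"
      have t: "t = last_partner Q m"
        and A: "restrict_partition (A t) P = restrict_partition (A t) Q"
        and B: "restrict_partition (B t) P = restrict_partition (B t) Q"
        using eq by (auto simp: f_def Let_def t_def)
      show "P = Q"
      proof (rule partition_on_eqI)
        show "partition_on Z P" "partition_on Z Q"
          using PQ by (auto simp: nc_partitions_def)
        show "same_block P x y \<longleftrightarrow> same_block Q x y" for x y
          using same_block_split[OF less.prems m PQ(1) t_def, of x y]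
            same_block_split[OF less.prems m PQ(2) t, of x y] A B
          unfolding A_def B_def by simp
      qed
    qed
    moreover have "f ` nc_partitions Z \<subseteq> (SIGMA t:Z. nc_partitions (A t) \<times> nc_partitions (B t))"
    proof
      fix y assume "y \<in> f ` nc_partitions Z"
      then obtain P where P: "P \<in> nc_partitions Z" "y = f P" by auto
      then have part: "partition_on Z P" by (simp add: nc_partitions_def)
      have "last_partner P m \<in> Z"
        using same_block_mem[OF part last_partner(1)[OF less.prems part m(1)]] by simp
      then show "y \<in> (SIGMA t:Z. nc_partitions (A t) \<times> nc_partitions (B t))"
        using P restrict_nc_partitions[OF P(1)] sub by (simp add: f_def Let_def)
    qed
    moreover have finS: "finite (nc_partitions (A t) \<times> nc_partitions (B t))" for t
      using fin by (intro finite_cartesian_product finite_nc_partitions)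
    ultimately have "card (nc_partitions Z) \<le> card (SIGMA t:Z. nc_partitions (A t) \<times> nc_partitions (B t))"
      using less.prems by (intro card_inj_on_le[of f]) auto
    also have "\<dots> = (\<Sum>t\<in>Z. card (nc_partitions (A t)) * card (nc_partitions (B t)))"
      using less.prems finS by (simp add: card_SigmaI card_cartesian_product)
    finally have "real (card (nc_partitions Z))
        \<le> (\<Sum>t\<in>Z. real (card (nc_partitions (A t))) * real (card (nc_partitions (B t))))"
      by (simp flip: of_nat_mult of_nat_sum)
    also have "\<dots> \<le> (\<Sum>t\<in>Z. catalan (card (A t)) * catalan (n - card (A t)))"
    proof (rule sum_mono)
      fix t assume "t \<in> Z"
      note c = cardAB[OF this]
      have "real (card (nc_partitions (A t))) \<le> catalan (card (A t))"
        using c n fin by (intro less.hyps) auto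
      moreover have "real (card (nc_partitions (B t))) \<le> catalan (card (B t))"
        using c n fin by (intro less.hyps) auto
      moreover have "n - card (A t) = card (B t)"
        using c by simp
      ultimately show "real (card (nc_partitions (A t))) * real (card (nc_partitions (B t)))
          \<le> catalan (card (A t)) * catalan (n - card (A t))"
        by (auto intro!: mult_mono catalan_nonneg)
    qed
    also have "\<dots> = (\<Sum>i\<in>(\<lambda>t. card (A t)) ` Z. catalan i * catalan (n - i))"
      by (simp add: sum.reindex[OF injA])
    also have "\<dots> \<le> (\<Sum>i\<le>n. catalan i * catalan (n - i))"
    proof (rule sum_mono2)
      show "(\<lambda>t. card (A t)) ` Z \<subseteq> {..n}"
        using cardAB by force
    qed (auto simp: catalan_nonneg)
    also have "\<dots> = catalan (card Z)"
      by (simp add: catalan_convolution n)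
    finally show ?thesis .
  qed
qed

section \<open>The binomial transform\<close>

lemma sum_Pow_card:
  fixes f :: "nat \<Rightarrow> real"
  assumes "finite A"
  shows "(\<Sum>Z\<in>Pow A. f (card Z)) = (\<Sum>k\<le>card A. real (card A choose k) * f k)"
proof -
  have "(\<Sum>Z\<in>Pow A. f (card Z)) = (\<Sum>k\<le>card A. \<Sum>Z\<in>{Z\<in>Pow A. card Z = k}. f (card Z))"
    using assms by (subst sum.group[where g = card]) (auto intro: card_mono)
  also have "\<dots> = (\<Sum>k\<le>card A. real (card A choose k) * f k)"
    using n_subsets[OF assms] by (intro sum.cong refl) simp
  finally show ?thesis .
qed

lemma card_Omega_le: "real (card (Omega h)) \<le> (\<Sum>k\<le>h. real (h choose k) * catalan k)"
proof -
  have "Omega h = (SIGMA Z:Pow {1..h}. nc_partitions Z)"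
    by (auto simp: Omega_def nc_partitions_def)
  then have "card (Omega h) = (\<Sum>Z\<in>Pow {1..h}. card (nc_partitions Z))"
    by (simp add: card_SigmaI finite_nc_partitions finite_subset)
  then have "real (card (Omega h)) = (\<Sum>Z\<in>Pow {1..h}. real (card (nc_partitions Z)))"
    by simp
  also have "\<dots> \<le> (\<Sum>Z\<in>Pow {1..h}. catalan (card Z))"
    by (intro sum_mono card_nc_partitions_le) (auto intro: finite_subset)
  also have "\<dots> = (\<Sum>k\<le>h. real (h choose k) * catalan k)"
    by (subst sum_Pow_card) auto
  finally show ?thesis .
qed

lemma inverse_sqrt_cube_le:
  fixes a b :: real
  assumes "a > 0" "b > 0"
  shows "1 / sqrt (a ^ 3) \<le> (1 + (b / a)\<^sup>2) / sqrt (b ^ 3)"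
proof -
  define s where "s = b / a"
  \<comment> \<open>This is a sum-of-squares certificate for
    \<open>s ^ 3 \<le> (1 + s\<^sup>2)\<^sup>2\<close>, whose root is the required bound.\<close>
  have "0 \<le> (s * (s - 1))\<^sup>2 + (s\<^sup>2)\<^sup>2 + 3 * s\<^sup>2 + 2"
    by (intro add_nonneg_nonneg mult_nonneg_nonneg zero_le_power2) auto
  also have "\<dots> = 2 * ((1 + s\<^sup>2)\<^sup>2 - s ^ 3)"
    by (simp add: power2_eq_square power3_eq_cube algebra_simps)
  finally have "s ^ 3 \<le> (1 + s\<^sup>2)\<^sup>2"
    by simp
  then have "sqrt (s ^ 3) \<le> 1 + s\<^sup>2"
    by (rule real_le_lsqrt[rotated -1]) auto
  then have "sqrt (s ^ 3) / sqrt (b ^ 3) \<le> (1 + s\<^sup>2) / sqrt (b ^ 3)"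
    using assms by (intro divide_right_mono) auto
  moreover have "sqrt (s ^ 3) / sqrt (b ^ 3) = 1 / sqrt (a ^ 3)"
    using assms by (simp add: s_def power_divide real_sqrt_divide)
  ultimately show ?thesis by (simp add: s_def)
qed

text \<open>Absorbing twice trades \<open>(h + 1) * (h + 2)\<close> for
  \<open>(k + 1) * (k + 2)\<close>. The factor 2 pays for
  \<open>k + 2 \<le> 2 * (k + 1)\<close>.\<close>

lemma binomial_div_square_le:
  "real (h choose k) * (real h / (real k + 1))\<^sup>2 \<le> 2 * real (Suc (Suc h) choose Suc (Suc k))"
proof -
  define a where "a = real (h choose k)"
  define b where "b = real (Suc (Suc h) choose Suc (Suc k))"
  have "Suc (Suc k) * Suc k * (Suc (Suc h) choose Suc (Suc k)) = Suc (Suc h) * Suc h * (h choose k)"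
    by (metis Suc_times_binomial mult.assoc mult.left_commute)
  then have "real (Suc (Suc k) * Suc k * (Suc (Suc h) choose Suc (Suc k)))
      = real (Suc (Suc h) * Suc h * (h choose k))"
    by (rule arg_cong)
  then have eq: "(real k + 2) * (real k + 1) * b = (real h + 2) * (real h + 1) * a"
    by (simp only: of_nat_mult of_nat_Suc a_def b_def) (simp add: algebra_simps)
  have "a * (real h)\<^sup>2 \<le> a * ((real h + 2) * (real h + 1))"
    by (intro mult_left_mono) (auto simp: a_def power2_eq_square algebra_simps)
  also have "\<dots> = (real k + 2) * (real k + 1) * b"
    using eq by (simp add: mult_ac)
  also have "\<dots> \<le> 2 * (real k + 1)\<^sup>2 * b"
    by (intro mult_right_mono) (auto simp: b_def power2_eq_square algebra_simps)
  finally have "a * (real h)\<^sup>2 \<le> 2 * b * (real k + 1)\<^sup>2"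
    by (simp add: mult_ac)
  then show ?thesis
    unfolding a_def[symmetric] b_def[symmetric] by (simp add: power_divide pos_divide_le_eq)
qed

lemma sum_binomial_four: "(\<Sum>k\<le>n. real (n choose k) * 4 ^ k) = 5 ^ n"
  using binomial_ring[of "4::real" 1 n] by simp

text \<open>Multiplied by 16, the sum is the expansion of \<open>(1 + 4) ^ (h + 2)\<close> without
  its first two terms.\<close>

lemma sum_binomial_shift_four_le:
  "(\<Sum>k\<le>h. real (Suc (Suc h) choose Suc (Suc k)) * 4 ^ k) \<le> 25 / 16 * 5 ^ h"
proof -
  have "16 * (\<Sum>k\<le>h. real (Suc (Suc h) choose Suc (Suc k)) * 4 ^ k)
      = (\<Sum>k\<le>h. real (Suc (Suc h) choose Suc (Suc k)) * 4 ^ Suc (Suc k))"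
    by (simp add: sum_distrib_left mult_ac del: binomial_Suc_Suc)
  also have "\<dots> \<le> (\<Sum>k\<le>Suc (Suc h). real (Suc (Suc h) choose k) * 4 ^ k)"
    by (simp only: sum.atMost_Suc_shift) (simp del: binomial_Suc_Suc)
  also have "\<dots> = 25 * 5 ^ h"
    by (simp only: sum_binomial_four) simp
  finally show ?thesis by simp
qed

text \<open>At \<open>h = 0\<close> the right side would be a division by zero, hence 0, although
  there is one state.\<close>

lemma card_Omega_bound:
  assumes "h > 0"
  shows "real (card (Omega h)) \<le> 5 * (5 ^ h / sqrt (real h ^ 3))"
proof -
  have "real (card (Omega h)) \<le> (\<Sum>k\<le>h. real (h choose k) * catalan k)"
    by (rule card_Omega_le)
  also have "\<dots> \<le> (\<Sum>k\<le>h. (real (h choose k) * 4 ^ k +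
      2 * (real (Suc (Suc h) choose Suc (Suc k)) * 4 ^ k)) / sqrt (real h ^ 3))"
  proof (rule sum_mono)
    fix k
    have "catalan k \<le> 4 ^ k * (1 / sqrt ((real k + 1) ^ 3))"
      using catalan_le[of k] by simp
    also have "\<dots> \<le> 4 ^ k * ((1 + (real h / (real k + 1))\<^sup>2) / sqrt (real h ^ 3))"
      using assms by (intro mult_left_mono inverse_sqrt_cube_le) auto
    finally have "real (h choose k) * catalan k
        \<le> real (h choose k) * (4 ^ k * ((1 + (real h / (real k + 1))\<^sup>2) / sqrt (real h ^ 3)))"
      by (intro mult_left_mono) auto
    also have "\<dots> = 4 ^ k * (real (h choose k) + real (h choose k) * (real h / (real k + 1))\<^sup>2)
        / sqrt (real h ^ 3)"
      by (simp add: distrib_left mult_ac)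
    also have "\<dots> \<le> 4 ^ k * (real (h choose k) + 2 * real (Suc (Suc h) choose Suc (Suc k)))
        / sqrt (real h ^ 3)"
      by (intro divide_right_mono mult_left_mono add_left_mono binomial_div_square_le) auto
    also have "\<dots> = (real (h choose k) * 4 ^ k +
        2 * (real (Suc (Suc h) choose Suc (Suc k)) * 4 ^ k)) / sqrt (real h ^ 3)"
      by (simp add: distrib_left mult_ac del: binomial_Suc_Suc)
    finally show "real (h choose k) * catalan k \<le> \<dots>" .
  qed
  also have "\<dots> = (5 ^ h + 2 * (\<Sum>k\<le>h. real (Suc (Suc h) choose Suc (Suc k)) * 4 ^ k))
      / sqrt (real h ^ 3)"
    by (simp only: sum_divide_distrib[symmetric] sum.distrib sum_distrib_left[symmetric]
        sum_binomial_four)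
  \<comment> \<open>The constant obtained is \<open>1 + 2 * 25 / 16 = 33 / 8\<close>, rounded up to
    5.\<close>
  also have "\<dots> \<le> (5 * 5 ^ h) / sqrt (real h ^ 3)"
  proof (rule divide_right_mono)
    have "(0::real) \<le> 5 ^ h"
      by simp
    then show "5 ^ h + 2 * (\<Sum>k\<le>h. real (Suc (Suc h) choose Suc (Suc k)) * 4 ^ k) \<le> 5 * 5 ^ h"
      using sum_binomial_shift_four_le[of h] by linarith
  qed simp
  finally show ?thesis by simp
qed

theorem theorem2:
  shows "(\<lambda>h::nat. real (card (Omega h))) \<in> O(\<lambda>h. 5 ^ h / sqrt (real h ^ 3))"
proof (rule bigoI)
  show "\<forall>\<^sub>F h in sequentially. norm (real (card (Omega h))) \<le> 5 * norm (5 ^ h / sqrt (real h ^ 3))"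
    using eventually_gt_at_top[of 0] by eventually_elim (use card_Omega_bound in simp)
qed

end
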